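(* Let $q$ be an odd prime power, let $r\ge 2$ be an integer, and let $a\in\mathrm{GF}(q^2)^*$ and $b\in\mathrm{GF}(q^2)\setminus\mathrm{GF}(q)$ satisfy $4a^{q+1}+(b^q-b)^2=0$. Let $\mathcal{B}(a,b)$ be the set of points $(x_1,\dots,x_r)$ of $\mathrm{AG}(r,q^2)$ satisfying \[x_r^q-x_r+a^q(x_1^{2q}+\dots+x_{r-1}^{2q})-a(x_1^2+\dots+x_{r-1}^2)=(b^q-b)(x_1^{q+1}+\dots+x_{r-1}^{q+1}).\] Then $|\mathcal{B}(a,b)|=q^{2r-1}$, and $\mathcal{B}(a,b)$ is a three-character set with respect to the hyperplanes of $\mathrm{AG}(r,q^2)$, i.e. for every hyperplane $H$ of $\mathrm{AG}(r,q^2)$ the number $|H\cap\mathcal{B}(a,b)|$ lies in the following set of three values: \begin{enumerate} \item if $r\equiv 1\pmod 4$, or $r$ is odd and $q\equiv 1\pmod 4$: $\{q^{2r-3}-q^{(3r-5)/2},\ q^{2r-3},\ q^{2r-3}-q^{(3r-5)/2}+q^{3(r-1)/2}\}$; \item if $r\equiv 3\pmod 4$ and $q\equiv 3\pmod 4$: $\{q^{2r-3}+q^{(3r-5)/2}-q^{3(r-1)/2},\ q^{2r-3},\ q^{2r-3}+q^{(3r-5)/2}\}$; \item if $r$ is even: $\{q^{2r-3}-q^{(3r-4)/2},\ q^{2r-3},\ q^{2r-3}+q^{(3r-4)/2}\}$. \end{enumerate} Furthermore, for $r>2$, $\mathcal{B}(a,b)$ is a minimal intersection set with respect to hyperplanes,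 i.e. a minimal $t$-intersection set where $t$ is the least number of points of $\mathcal{B}(a,b)$ on a hyperplane of $\mathrm{AG}(r,q^2)$.
   Context: A set $S$ of points of $\mathrm{AG}(r,q^2)$ is a $t$-intersection set (with respect to hyperplanes) if every hyperplane contains at least $t>0$ points of $S$. A point $P\in S$ is essential if $S\setminus\{P\}$ is not a $t$-intersection set; $S$ is minimal if all its points are essential. A set is an $m$-character set if its intersection sizes with hyperplanes take only $m$ possible values (the characters). *)

theory Defs
  imports "HOL-Number_Theory.Prime_Powers" "HOL-Library.FuncSet" "HOL-Library.Cardinality"
begin

definition is_subfield :: "'a::field set \<Rightarrow> bool" where
  "is_subfield K \<longleftrightarrow> 0 \<in> K \<and> 1 \<in> K \<and>
     (\<forall>x\<in>K. \<forall>y\<in>K. x + y \<in> K \<and> x * y \<in> K) \<and>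
     (\<forall>x\<in>K. - x \<in> K \<and> inverse x \<in> K)"

(* The points of AG(r, F), for F the field 'a, are the coordinate tuples x 1, ..., x r;
   extensionality outside {1..r} makes each point a unique function. *)
definition AG :: "nat \<Rightarrow> (nat \<Rightarrow> 'a) set" where
  "AG r = {1..r} \<rightarrow>\<^sub>E UNIV"

definition hyperplanes :: "nat \<Rightarrow> (nat \<Rightarrow> 'a::field) set set" where
  "hyperplanes r =
     {H. \<exists>c d. (\<exists>i\<in>{1..r}. c i \<noteq> 0) \<and> H = {x \<in> AG r. (\<Sum>i=1..r. c i * x i) = d}}"

definition intersection_numbers :: "nat \<Rightarrow> (nat \<Rightarrow> 'a::field) set \<Rightarrow> nat set" where
  "intersection_numbers r S = (\<lambda>H. card (H \<inter> S)) ` hyperplanes r"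

definition intersection_set :: "nat \<Rightarrow> nat \<Rightarrow> (nat \<Rightarrow> 'a::field) set \<Rightarrow> bool" where
  "intersection_set r t S \<longleftrightarrow>
     S \<subseteq> AG r \<and> t > 0 \<and> (\<forall>H\<in>hyperplanes r. t \<le> card (H \<inter> S))"

definition essential :: "nat \<Rightarrow> nat \<Rightarrow> (nat \<Rightarrow> 'a::field) set \<Rightarrow> (nat \<Rightarrow> 'a) \<Rightarrow> bool" where
  "essential r t S P \<longleftrightarrow> P \<in> S \<and> \<not> intersection_set r t (S - {P})"

definition minimal_intersection_set :: "nat \<Rightarrow> nat \<Rightarrow> (nat \<Rightarrow> 'a::field) set \<Rightarrow> bool" where
  "minimal_intersection_set r t S \<longleftrightarrow>
     intersection_set r t S \<and> (\<forall>P\<in>S. essential r t S P)"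

definition BB :: "nat \<Rightarrow> nat \<Rightarrow> 'a::field \<Rightarrow> 'a \<Rightarrow> (nat \<Rightarrow> 'a) set" where
  "BB q r a b =
     {x \<in> AG r.
        x r ^ q - x r + a ^ q * (\<Sum>i=1..r-1. x i ^ (2 * q)) - a * (\<Sum>i=1..r-1. x i ^ 2)
        = (b ^ q - b) * (\<Sum>i=1..r-1. x i ^ (q + 1))}"

end

theory Submission
  imports Defs "HOL-Computational_Algebra.Polynomial"
begin

text \<open>
  The condition on \<open>a\<close> and \<open>b\<close> says that the form \<open>a\<^sup>q x\<^sup>2\<^sup>q - a x\<^sup>2 - (b\<^sup>q - b) x\<^sup>q\<^sup>+\<^sup>1\<close> has rank one over
  \<open>K = GF(q)\<close>. With a suitable purely imaginary \<open>A\<close>, a suitable \<open>\<kappa>\<close> and the \<open>K\<close>-linear form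
  \<open>tr z = (z\<^sup>q - z) / A\<close>, the equation of \<open>\<B>(a, b)\<close> becomes \<open>tr x\<^sub>r = \<Sum>\<^sub>i (tr (\<kappa> x\<^sub>i))\<^sup>2\<close>.
  On a hyperplane \<open>x\<^sub>r = d - \<Sum>\<^sub>i c\<^sub>i x\<^sub>i\<close> this reads \<open>\<Sum>\<^sub>i (tr (\<kappa> x\<^sub>i))\<^sup>2 + tr (c\<^sub>i x\<^sub>i) = tr d\<close>. If some
  \<open>c\<^sub>j / \<kappa>\<close> is not in \<open>K\<close>, translating \<open>x\<^sub>j\<close> along the kernel of \<open>tr (\<kappa> x\<^sub>j)\<close> shows that every value is
  taken equally often; otherwise one completes the square, and what remains is the number of
  representations of an element of \<open>K\<close> as a sum of \<open>r - 1\<close> squares. Its deviation from the mean is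
  multiplied by \<open>\<sigma> q\<close> when two squares are added, where \<open>\<sigma> = 1\<close> if \<open>- 1\<close> is a square in \<open>K\<close>, i.e. if
  \<open>q \<equiv> 1\<close> modulo \<open>4\<close>, and \<open>\<sigma> = - 1\<close> otherwise. As \<open>r - 1 \<ge> 2\<close> squares represent
  every element of \<open>K\<close>, each point lies on hyperplanes of every size of the latter kind; the least of
  these sizes does not exceed their average \<open>q\<^sup>2\<^sup>r\<^sup>-\<^sup>3\<close>, so it is the least intersection number.
\<close>

subsection \<open>Counting\<close>

text \<open>Splitting off one coordinate serves both the recursion for sums of squares and the
  separation of the last coordinate of a point.\<close>

lemma card_PiE_insert_Collect:
  assumes "finite I" "a \<notin> I" "\<And>i. i \<in> insert a I \<Longrightarrow> finite (W i)"
  shows "card {f \<in> Pi\<^sub>E (insert a I) W. P f} = (\<Sum>u\<in>W a. card {g \<in> Pi\<^sub>E I W. P (g(a := u))})"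
proof -
  let ?S = "SIGMA u:W a. {g \<in> Pi\<^sub>E I W. P (g(a := u))}"
  have fin: "finite (Pi\<^sub>E I W)" using assms by (intro finite_PiE) auto
  have "bij_betw (\<lambda>(u, g). g(a := u)) ?S {f \<in> Pi\<^sub>E (insert a I) W. P f}"
  proof (rule bij_betw_imageI)
    show "inj_on (\<lambda>(u, g). g(a := u)) ?S"
      using inj_combinator[OF assms(2), of W] by (rule inj_on_subset) auto
    show "(\<lambda>(u, g). g(a := u)) ` ?S = {f \<in> Pi\<^sub>E (insert a I) W. P f}"
      unfolding PiE_insert_eq by force
  qed
  then have "card {f \<in> Pi\<^sub>E (insert a I) W. P f} = card ?S"
    by (simp add: bij_betw_same_card)
  also have "\<dots> = (\<Sum>u\<in>W a. card {g \<in> Pi\<^sub>E I W. P (g(a := u))})"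
    using assms fin by (intro card_SigmaI) auto
  finally show ?thesis .
qed

lemma sum_card_swap:
  assumes "finite A" "finite B"
  shows "(\<Sum>x\<in>A. card {y \<in> B. P x y}) = (\<Sum>y\<in>B. card {x \<in> A. P x y})"
  using sum_multicount_gen[of A B "\<lambda>x y. P x y" "\<lambda>y. card {x \<in> A. P x y}"] assms
  by simp

lemma card_eq_sum_fibres:
  assumes "finite S" "finite V" "G ` S \<subseteq> V"
  shows "card S = (\<Sum>v\<in>V. card {x \<in> S. G x = v})"
proof -
  have "(\<Sum>v\<in>V. card {x \<in> S. G x = v}) = (\<Sum>x\<in>S. card {v \<in> V. G x = v})"
    by (rule sum_card_swap) (use assms in auto)
  also have "\<dots> = (\<Sum>x\<in>S. 1)"
  proof (rule sum.cong)
    fix x assume "x \<in> S"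
    then have "{v \<in> V. G x = v} = {G x}" using assms by auto
    then show "card {v \<in> V. G x = v} = 1" by simp
  qed simp
  finally show ?thesis by simp
qed

text \<open>Each ordered pair of values comes with an injection that bounds one fibre by the other;
  exchanging the two values gives equality.\<close>

lemma card_equidistributed:
  assumes "finite S" "finite V" "G ` S \<subseteq> V"
    and move: "\<And>u v. u \<in> V \<Longrightarrow> v \<in> V \<Longrightarrow>
      \<exists>h. inj_on h S \<and> (\<forall>x\<in>S. G x = u \<longrightarrow> h x \<in> S \<and> G (h x) = v)"
    and "v \<in> V"
  shows "card V * card {x \<in> S. G x = v} = card S"
proof -
  have le: "card {x \<in> S. G x = u} \<le> card {x \<in> S. G x = w}" if uw: "u \<in> V" "w \<in> V" for u w
  proof -
    obtain h where h: "inj_on h S" "\<forall>x\<in>S. G x = u \<longrightarrow> h x \<in> S \<and> G (h x) = w"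
      using move[OF uw] by blast
    show ?thesis
      using h assms(1) by (intro card_inj_on_le[of h]) (auto intro: inj_on_subset)
  qed
  have "card S = (\<Sum>u\<in>V. card {x \<in> S. G x = u})"
    by (rule card_eq_sum_fibres) (use assms in auto)
  also have "\<dots> = (\<Sum>u\<in>V. card {x \<in> S. G x = v})"
    by (rule sum.cong) (use le assms(5) in \<open>auto intro: antisym\<close>)
  finally show ?thesis by simp
qed

subsection \<open>Sums of squares in a finite field\<close>

locale finite_subfield =
  fixes K :: "'a::{field,finite} set"
  assumes subfield: "is_subfield K"
begin

section \<open>Arithmetic inside \<open>K\<close>\<close>

lemma zero_mem [simp, intro]: "0 \<in> K"
  and one_mem [simp, intro]: "1 \<in> K"
  and add_mem [simp, intro]: "x \<in> K \<Longrightarrow> y \<in> K \<Longrightarrow> x + y \<in> K"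
  and mult_mem [simp, intro]: "x \<in> K \<Longrightarrow> y \<in> K \<Longrightarrow> x * y \<in> K"
  and uminus_mem [simp, intro]: "x \<in> K \<Longrightarrow> - x \<in> K"
  and inverse_mem [simp, intro]: "x \<in> K \<Longrightarrow> inverse x \<in> K"
  using subfield unfolding is_subfield_def by auto

lemma diff_mem [simp, intro]: "x \<in> K \<Longrightarrow> y \<in> K \<Longrightarrow> x - y \<in> K"
  using add_mem[of x "- y"] by simp

lemma divide_mem [simp, intro]: "x \<in> K \<Longrightarrow> y \<in> K \<Longrightarrow> x / y \<in> K"
  by (simp add: divide_inverse)

lemma power_mem [simp, intro]: "x \<in> K \<Longrightarrow> x ^ n \<in> K"
  by (induction n) auto

lemma sum_mem [intro]: "(\<And>i. i \<in> I \<Longrightarrow> f i \<in> K) \<Longrightarrow> sum f I \<in> K"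
  by (induction I rule: infinite_finite_induct) auto

lemma nonempty [simp]: "K \<noteq> {}"
  using zero_mem by blast

lemma card_gt_0: "card K > 0"
  by (auto simp: card_gt_0_iff)

text \<open>Translation by 1 permutes \<open>K\<close>, so adding 1 to every summand leaves the sum
  of all elements unchanged.\<close>

lemma of_nat_card: "of_nat (card K) = (0 :: 'a)"
proof -
  have "(\<Sum>x\<in>K. x + 1) = (\<Sum>x\<in>K. x)"
    by (rule sum.reindex_bij_witness[of _ "\<lambda>x. x - 1" "\<lambda>x. x + 1"]) auto
  then show ?thesis by (simp add: sum.distrib)
qed

text \<open>Multiplication by a nonzero \<open>x\<close> permutes \<open>K - {0}\<close>; comparing
  the products over all units gives \<open>x ^ (card K - 1) = 1\<close>.\<close>

lemma power_card:
  assumes "x \<in> K"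
  shows "x ^ card K = x"
proof (cases "x = 0")
  case False
  have "(\<Prod>y\<in>K - {0}. x * y) = (\<Prod>y\<in>K - {0}. y)"
    by (rule prod.reindex_bij_witness[of _ "\<lambda>y. y / x" "\<lambda>y. x * y"]) (use False assms in auto)
  then have "x ^ (card K - 1) = 1"
    by (simp add: prod.distrib)
  then have "x ^ Suc (card K - 1) = x" by simp
  then show ?thesis using card_gt_0 by simp
qed (use card_gt_0 in simp)

section \<open>Numbers of representations as sums of squares\<close>

definition sqsum :: "nat \<Rightarrow> 'a \<Rightarrow> nat" where
  "sqsum n e = card {y \<in> {1..n} \<rightarrow>\<^sub>E K. (\<Sum>i=1..n. y i ^ 2) = e}"

text \<open>On \<open>K\<close> this agrees with \<open>sqsum 2\<close>; with pairs in place of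
  functions, rotations are easy to write down.\<close>

definition circle :: "'a \<Rightarrow> nat" where
  "circle e = card {p \<in> K \<times> K. fst p ^ 2 + snd p ^ 2 = e}"

text \<open>For odd \<open>card K\<close> this is the quadratic character of \<open>K\<close> at
  \<open>- 1\<close>.\<close>

definition \<sigma> :: int where
  "\<sigma> = (if \<exists>i\<in>K. i ^ 2 = - 1 then 1 else - 1)"

lemma sqsum_0: "sqsum 0 e = (if e = 0 then 1 else 0)"
  by (auto simp: sqsum_def)

lemma sqsum_Suc: "sqsum (Suc n) e = (\<Sum>u\<in>K. sqsum n (e - u ^ 2))"
proof -
  have I: "{1..Suc n} = insert (Suc n) {1..n}" by auto
  have "sqsum (Suc n) e = (\<Sum>u\<in>K. card {g \<in> {1..n} \<rightarrow>\<^sub>E K.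
      (\<Sum>i=1..Suc n. (g(Suc n := u)) i ^ 2) = e})"
    unfolding sqsum_def I by (rule card_PiE_insert_Collect) auto
  also have "\<dots> = (\<Sum>u\<in>K. sqsum n (e - u ^ 2))"
    unfolding sqsum_def
    by (intro sum.cong refl arg_cong[where f = card] Collect_cong) (auto simp: algebra_simps)
  finally show ?thesis .
qed

text \<open>Grouping the pairs by \<open>u ^ 2 + v ^ 2\<close> lets two squares be split off at
  once, with weight \<open>circle\<close>.\<close>

lemma sum_circle:
  fixes h :: "'a \<Rightarrow> nat"
  shows "(\<Sum>u\<in>K. \<Sum>v\<in>K. h (u ^ 2 + v ^ 2)) = (\<Sum>f\<in>K. circle f * h f)"
proof -
  have "(\<Sum>u\<in>K. \<Sum>v\<in>K. h (u ^ 2 + v ^ 2)) = (\<Sum>p\<in>K \<times> K. h (fst p ^ 2 + snd p ^ 2))"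
    by (simp add: sum.cartesian_product case_prod_unfold)
  also have "\<dots> = (\<Sum>f\<in>K. \<Sum>p | p \<in> K \<times> K \<and> fst p ^ 2 + snd p ^ 2 = f. h (fst p ^ 2 + snd p ^ 2))"
    by (rule sum.group[symmetric]) auto
  also have "\<dots> = (\<Sum>f\<in>K. circle f * h f)"
    by (rule sum.cong) (auto simp: circle_def)
  finally show ?thesis .
qed

lemma sqsum_Suc_Suc: "sqsum (Suc (Suc n)) e = (\<Sum>f\<in>K. circle f * sqsum n (e - f))"
  by (simp add: sqsum_Suc sum_circle[symmetric] diff_diff_eq)

lemma sqsum_2: "e \<in> K \<Longrightarrow> sqsum 2 e = circle e"
  by (simp add: numeral_2_eq_2 sqsum_Suc_Suc sqsum_0 if_distrib sum.delta cong: if_cong)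

lemma sum_sqsum: "(\<Sum>f\<in>K. sqsum n f) = card K ^ n"
proof -
  have "card ({1..n} \<rightarrow>\<^sub>E K) = (\<Sum>f\<in>K. sqsum n f)"
    unfolding sqsum_def by (rule card_eq_sum_fibres) (auto simp: finite_PiE intro!: sum_mem dest: PiE_mem)
  then show ?thesis by (simp add: card_PiE)
qed

lemma sum_sqsum_diff:
  assumes "e \<in> K"
  shows "(\<Sum>f\<in>K. sqsum n (e - f)) = card K ^ n"
  unfolding sum_sqsum[symmetric]
  by (rule sum.reindex_bij_witness[of _ "\<lambda>f. e - f" "\<lambda>f. e - f"]) (use assms in auto)

end

section \<open>Exact representation numbers for odd \<open>card K\<close>\<close>

locale odd_subfield = finite_subfield +
  assumes odd_card: "odd (card K)"
begin

text \<open>The odd number \<open>card K\<close> is zero in the field, so \<open>2 = 0\<close> would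
  force \<open>1 = 0\<close>.\<close>

lemma two_neq_0: "(2 :: 'a) \<noteq> 0"
proof
  assume 2: "(2 :: 'a) = 0"
  obtain m where "card K = 2 * m + 1" using odd_card by (auto elim: oddE)
  then have "(of_nat (card K) :: 'a) = 2 * of_nat m + 1" by simp
  then show False using 2 of_nat_card by simp
qed

lemma uminus_neq: "x \<noteq> 0 \<Longrightarrow> - x \<noteq> (x :: 'a)"
  using two_neq_0 by (metis add.right_inverse mult_2 mult_eq_0_iff)

lemma card_sqrt_le: "card {u \<in> K. u ^ 2 = s} \<le> (if s = 0 then 1 else 2)"
proof (cases "\<exists>w\<in>K. w ^ 2 = s")
  case True
  then obtain w where w: "w ^ 2 = s" by blast
  have "{u \<in> K. u ^ 2 = s} \<subseteq> {w, - w}"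
    using w by (auto simp: power2_eq_iff)
  from card_mono[OF _ this] have "card {u \<in> K. u ^ 2 = s} \<le> card {w, - w}" by simp
  also have "\<dots> \<le> (if s = 0 then 1 else 2)" using w by (auto simp: card_insert_if)
  finally show ?thesis .
next
  case False
  then have "{u \<in> K. u ^ 2 = s} = {}" by auto
  then show ?thesis by (metis card.empty zero_le)
qed

text \<open>More than half of the elements of \<open>K\<close> are squares, so \<open>s\<close> and \<open>f - s\<close> are both squares for some \<open>s\<close>.\<close>
lemma sum_two_squares:
  assumes "f \<in> K"
  obtains u v where "u \<in> K" "v \<in> K" "u ^ 2 + v ^ 2 = f"
proof -
  define S where "S = (\<lambda>u. u ^ 2) ` K"
  have "0 \<in> S" unfolding S_def by (intro image_eqI[of _ _ 0]) auto
  have "card K = (\<Sum>s\<in>S. card {u \<in> K. u ^ 2 = s})"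
    by (rule card_eq_sum_fibres) (auto simp: S_def)
  also have "\<dots> \<le> (\<Sum>s\<in>S. if s = 0 then 1 else 2)"
    by (rule sum_mono) (rule card_sqrt_le)
  also have "\<dots> = 1 + (\<Sum>s\<in>S - {0}. 2)"
    using \<open>0 \<in> S\<close> by (subst sum.remove[of _ 0]) (auto intro!: sum.cong)
  \<comment> \<open>Zero has only one square root. The 1 gained this way makes the bound
    \<open>card K < 2 * card S\<close> strict.\<close>
  also have "\<dots> + 1 = 2 * card S"
    using \<open>0 \<in> S\<close> card_gt_0_iff[of S] by (auto simp: card_Diff_singleton)
  finally have big: "card K < card S + card S" by simp
  have "card ((\<lambda>s. f - s) ` S) = card S" by (rule card_image) (auto simp: inj_on_def)
  moreover have "card (S \<union> (\<lambda>s. f - s) ` S) \<le> card K"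
    by (rule card_mono) (use assms in \<open>auto simp: S_def\<close>)
  ultimately have "S \<inter> (\<lambda>s. f - s) ` S \<noteq> {}"
    using big card_Un_disjoint[of S "(\<lambda>s. f - s) ` S"] by auto
  then obtain u v where "u \<in> K" "v \<in> K" "u ^ 2 = f - v ^ 2" by (auto simp: S_def)
  then show ?thesis using that[of u v] by (simp add: algebra_simps)
qed

text \<open>Multiplying by a representation \<open>s\<^sup>2 + t\<^sup>2\<close> of \<open>g / f\<close> rotates the circle of \<open>f\<close> into that of \<open>g\<close>.\<close>
lemma circle_le:
  assumes "f \<in> K" "g \<in> K" "f \<noteq> 0" "g \<noteq> 0"
  shows "circle f \<le> circle g"
proof -
  obtain s t where st: "s \<in> K" "t \<in> K" "s ^ 2 + t ^ 2 = g / f"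
    using sum_two_squares[of "g / f"] assms by auto
  define h where "h = (\<lambda>(u, v). (s * u - t * v, t * u + s * v))"
  have nz: "s ^ 2 + t ^ 2 \<noteq> 0" using st assms by simp
  have inj: "inj h"
  proof (rule injI)
    fix p p' assume eq: "h p = h p'"
    obtain u v u' v' where p: "p = (u, v)" "p' = (u', v')" by (cases p, cases p')
    have e1: "s * u - t * v = s * u' - t * v'" and e2: "t * u + s * v = t * u' + s * v'"
      using eq by (auto simp: h_def p)
    \<comment> \<open>The adjugate of the rotation matrix recovers \<open>u\<close>, and below
      \<open>v\<close>, up to the nonzero determinant \<open>s ^ 2 + t ^ 2\<close>.\<close>
    have "(s ^ 2 + t ^ 2) * u = s * (s * u - t * v) + t * (t * u + s * v)"
      by (simp add: algebra_simps power2_eq_square)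
    also have "\<dots> = (s ^ 2 + t ^ 2) * u'"
      unfolding e1 e2 by (simp add: algebra_simps power2_eq_square)
    finally have "u = u'" using nz by simp
    have "(s ^ 2 + t ^ 2) * v = s * (t * u + s * v) - t * (s * u - t * v)"
      by (simp add: algebra_simps power2_eq_square)
    also have "\<dots> = (s ^ 2 + t ^ 2) * v'"
      unfolding e1 e2 by (simp add: algebra_simps power2_eq_square)
    finally show "p = p'" using nz \<open>u = u'\<close> p by simp
  qed
  have "(s * u - t * v) ^ 2 + (t * u + s * v) ^ 2 = (s ^ 2 + t ^ 2) * (u ^ 2 + v ^ 2)" for u v
    by (simp add: algebra_simps power2_eq_square)
  then show ?thesis
    unfolding circle_def using inj st assms
    by (intro card_inj_on_le[of h]) (auto simp: h_def intro: inj_on_subset)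
qed

text \<open>With a root \<open>i\<close> of \<open>- 1\<close>, the form splits into two lines that
  meet only in the origin; without one, the origin is its only zero.\<close>

lemma circle_0: "int (circle 0) = int (card K) + \<sigma> * (int (card K) - 1)"
proof (cases "\<exists>i\<in>K. i ^ 2 = - 1")
  case True
  then obtain i where i: "i \<in> K" "i ^ 2 = - 1" by blast
  have i0: "i \<noteq> 0" using i by auto
  let ?P = "(\<lambda>v. (i * v, v)) ` K" and ?M = "(\<lambda>v. (- i * v, v)) ` K"
  have "u ^ 2 + v ^ 2 = 0 \<longleftrightarrow> u = i * v \<or> u = - i * v" for u v
  proof -
    have "(u - i * v) * (u + i * v) = u ^ 2 - i ^ 2 * v ^ 2"
      by (simp add: algebra_simps power2_eq_square)
    also have "\<dots> = u ^ 2 + v ^ 2" using i by simp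
    finally have "u ^ 2 + v ^ 2 = (u - i * v) * (u + i * v)" ..
    then show ?thesis by (simp add: eq_neg_iff_add_eq_0)
  qed
  then have eq: "{p \<in> K \<times> K. fst p ^ 2 + snd p ^ 2 = 0} = ?P \<union> ?M"
    using i by auto
  have int: "?P \<inter> ?M = {(0, 0)}"
  proof (intro equalityI subsetI)
    fix p assume "p \<in> ?P \<inter> ?M"
    then obtain v w where "p = (i * v, v)" "p = (- i * w, w)" by blast
    then have v: "p = (i * v, v)" "- (i * v) = i * v" by (metis Pair_inject mult_minus_left)+
    then have "i * v = 0" using uminus_neq[of "i * v"] by argo
    then show "p \<in> {(0, 0)}" using v(1) i0 by simp
  next
    fix p :: "'a \<times> 'a" assume "p \<in> {(0, 0)}"
    then show "p \<in> ?P \<inter> ?M" by (auto intro!: image_eqI[of _ _ 0])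
  qed
  have "card ?P = card K" "card ?M = card K"
    by (auto intro!: card_image simp: inj_on_def)
  then have "circle 0 + 1 = 2 * card K"
    unfolding circle_def eq using card_Un_Int[of ?P ?M] int by simp
  then show ?thesis using True by (simp add: \<sigma>_def)
next
  case False
  have "u = 0 \<and> v = 0" if "u \<in> K" "v \<in> K" "u ^ 2 + v ^ 2 = 0" for u v
  proof (cases "v = 0")
    case False
    then have "(u / v) ^ 2 = - 1"
      using that(3) by (simp add: power_divide field_simps eq_neg_iff_add_eq_0)
    then show ?thesis using \<open>\<not> (\<exists>i\<in>K. i ^ 2 = - 1)\<close> that by blast
  qed (use that in auto)
  then have "u ^ 2 + v ^ 2 = 0 \<longleftrightarrow> u = 0 \<and> v = 0" if "u \<in> K" "v \<in> K" for u v
    using that by (metis add.left_neutral power_zero_numeral)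
  then have "{p \<in> K \<times> K. fst p ^ 2 + snd p ^ 2 = 0} = {(0, 0)}" by auto
  then show ?thesis using False by (simp add: circle_def \<sigma>_def)
qed

lemma card_gt_1: "card K > 1"
proof -
  have "card {0, 1 :: 'a} \<le> card K" by (rule card_mono) auto
  then show ?thesis by simp
qed

text \<open>By \<open>circle_le\<close> in both directions, the pairs outside
  \<open>circle 0\<close> are spread evenly over the \<open>card K - 1\<close> nonzero
  values.\<close>

lemma circle_eq:
  assumes "f \<in> K"
  shows "int (circle f) = int (card K) - \<sigma> + (if f = 0 then \<sigma> * int (card K) else 0)"
proof (cases "f = 0")
  case False
  have "card (K \<times> K) = (\<Sum>g\<in>K. circle g)"
    unfolding circle_def by (rule card_eq_sum_fibres) auto
  also have "\<dots> = circle 0 + (\<Sum>g\<in>K - {0}. circle g)"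
    by (rule sum.remove) auto
  also have "(\<Sum>g\<in>K - {0}. circle g) = (\<Sum>g\<in>K - {0}. circle f)"
    by (rule sum.cong) (use circle_le assms False in \<open>auto intro: antisym\<close>)
  finally have "card K * card K = circle 0 + (card K - 1) * circle f"
    by (simp add: card_cartesian_product)
  then have "int (card K) * int (card K) = int (circle 0) + int (card K - 1) * int (circle f)"
    by (metis of_nat_add of_nat_mult)
  moreover have "int (card K - 1) = int (card K) - 1" using card_gt_0 by linarith
  ultimately have "int (card K) * int (card K) = int (circle 0) + (int (card K) - 1) * int (circle f)"
    by simp
  then have "(int (card K) - 1) * int (circle f) = (int (card K) - 1) * (int (card K) - \<sigma>)"
    by (simp add: circle_0 algebra_simps)
  then show ?thesis using card_gt_1 False by simp
qed (simp add: circle_0 algebra_simps)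

text \<open>Write \<open>circle\<close> as a constant plus a spike at 0. The constant part sees only
  the total \<open>sum_sqsum_diff\<close>, so the spike alone carries the deviation from the mean.
  With \<open>Suc m\<close> squares the mean is \<open>card K ^ m\<close>, which avoids subtraction
  in the exponent.\<close>

lemma sqsum_step:
  assumes "e \<in> K"
  shows "int (sqsum (Suc (Suc (Suc m))) e) - int (card K) ^ (m + 2) =
    \<sigma> * int (card K) * (int (sqsum (Suc m) e) - int (card K) ^ m)"
proof -
  let ?q = "int (card K)"
  let ?N = "\<lambda>f. int (sqsum (Suc m) f)"
  have "int (sqsum (Suc (Suc (Suc m))) e) = (\<Sum>f\<in>K. int (circle f) * ?N (e - f))"
    by (simp add: sqsum_Suc_Suc)
  also have "\<dots> = (\<Sum>f\<in>K. (?q - \<sigma>) * ?N (e - f) + (if f = 0 then \<sigma> * ?q * ?N (e - f) else 0))"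
    by (rule sum.cong) (auto simp: circle_eq algebra_simps)
  also have "\<dots> = (?q - \<sigma>) * (\<Sum>f\<in>K. ?N (e - f)) + \<sigma> * ?q * ?N e"
    by (simp add: sum.distrib sum_distrib_left sum.delta)
  also have "(\<Sum>f\<in>K. ?N (e - f)) = ?q ^ Suc m"
    using sum_sqsum_diff[OF assms, of "Suc m"] by (metis of_nat_power of_nat_sum)
  finally show ?thesis by (simp add: algebra_simps)
qed

text \<open>One square represents \<open>e\<close> in 0, 1 or 2 ways, a deviation of
  \<open>- 1\<close>, 0 or 1 from the mean; each further pair of squares multiplies it by
  \<open>card K\<close> up to sign.\<close>

lemma sqsum_odd:
  assumes "e \<in> K"
  shows "int (sqsum (2 * k + 1) e) - int (card K) ^ (2 * k) \<in>
    {- (int (card K) ^ k), 0, int (card K) ^ k}"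
proof (induction k)
  case 0
  have "sqsum 1 e = (\<Sum>u\<in>K. if u ^ 2 = e then 1 else 0)"
    unfolding One_nat_def sqsum_Suc sqsum_0 by (rule sum.cong) auto
  also have "\<dots> = card {u \<in> K. u ^ 2 = e}" by (simp add: sum.If_cases Int_def conj_commute)
  also have "\<dots> \<le> 2" using card_sqrt_le[of e] by (simp split: if_splits)
  finally have "sqsum 1 e = 0 \<or> sqsum 1 e = 1 \<or> sqsum 1 e = 2" by linarith
  then show ?case by auto
next
  case (Suc k)
  let ?D = "\<lambda>k. int (sqsum (2 * k + 1) e) - int (card K) ^ (2 * k)"
  have "\<sigma> = 1 \<or> \<sigma> = - 1" by (simp add: \<sigma>_def)
  moreover have "?D (Suc k) = \<sigma> * int (card K) * ?D k"
    using sqsum_step[OF assms, of "2 * k"] by simp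
  ultimately show ?case using Suc by auto
qed

lemma sqsum_even:
  assumes "e \<in> K"
  shows "int (sqsum (2 * k + 2) e) = int (card K) ^ (2 * k + 1) +
    \<sigma> ^ (k + 1) * (if e = 0 then int (card K) ^ (k + 1) - int (card K) ^ k else - (int (card K) ^ k))"
proof (induction k)
  case 0
  show ?case using assms by (simp add: sqsum_2[unfolded numeral_2_eq_2] circle_eq algebra_simps)
next
  case (Suc k)
  show ?case
    using Suc sqsum_step[OF assms, of "2 * k + 1"] by (simp add: algebra_simps)
qed

text \<open>The polynomial \<open>x ^ (2 * m) - 1\<close> has too few roots to vanish on all
  \<open>4 * m\<close> units. A unit \<open>x\<close> that is not a root has
  \<open>x ^ (2 * m) = - 1\<close>, so \<open>x ^ m\<close> is a square root of
  \<open>- 1\<close>.\<close>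

lemma sigma_eq_1:
  assumes "card K mod 4 = 1"
  shows "\<sigma> = 1"
proof -
  define m where "m = card K div 4"
  have m: "card K = 4 * m + 1" using assms unfolding m_def by presburger
  have "m > 0" using m card_gt_1 by auto
  define p :: "'a poly" where "p = monom 1 (2 * m) + [:- 1:]"
  have deg: "degree p = 2 * m"
    unfolding p_def using \<open>m > 0\<close> by (subst degree_add_eq_left) (auto simp: degree_monom_eq)
  then have "p \<noteq> 0" using \<open>m > 0\<close> by auto
  from card_poly_roots_bound[OF this] have "card {x :: 'a. x ^ (2 * m) = 1} \<le> 2 * m"
    unfolding deg by (simp add: p_def poly_monom)
  moreover have "card (K - {0}) = 4 * m" using m by simp
  ultimately have "\<not> K - {0} \<subseteq> {x. x ^ (2 * m) = 1}"
    using card_mono[of "{x. x ^ (2 * m) = (1 :: 'a)}" "K - {0}"] \<open>m > 0\<close> by auto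
  then obtain x where x: "x \<in> K" "x \<noteq> 0" "x ^ (2 * m) \<noteq> 1" by auto
  have "x * (x ^ (2 * m)) ^ 2 = x ^ card K" unfolding m by (simp add: power_mult[symmetric] mult.commute)
  then have "(x ^ (2 * m)) ^ 2 = 1" using power_card[OF x(1)] x(2) by simp
  then have "x ^ (2 * m) = - 1" using x(3) by (simp add: power2_eq_1_iff)
  then have "(x ^ m) ^ 2 = - 1" by (simp add: power_mult[symmetric] mult.commute)
  then show ?thesis using x(1) unfolding \<sigma>_def by (auto intro!: bexI[of _ "x ^ m"])
qed

text \<open>A square root \<open>i\<close> of \<open>- 1\<close> would satisfy
  \<open>i ^ card K = - i\<close>, against \<open>power_card\<close>.\<close>

lemma sigma_eq_m1:
  assumes "card K mod 4 = 3"
  shows "\<sigma> = - 1"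
proof -
  define m where "m = card K div 4"
  have m: "card K = 4 * m + 3" using assms unfolding m_def by presburger
  have False if i: "i \<in> K" "i ^ 2 = - 1" for i
  proof -
    have "card K = Suc (2 * (2 * m + 1))" using m by simp
    then have "i ^ card K = i * (i ^ 2) ^ (2 * m + 1)" by (simp only: power_Suc power_mult)
    also have "\<dots> = - i" using i by simp
    finally have "- i = i" using power_card[OF i(1)] by simp
    moreover have "i \<noteq> 0" using i by auto
    ultimately show False using uminus_neq by blast
  qed
  then show ?thesis by (auto simp: \<sigma>_def)
qed

lemma sum_squares_surj:
  assumes "e \<in> K" "(n :: nat) \<ge> 2"
  obtains y where "\<And>i. y i \<in> K" "(\<Sum>i=1..n. y i ^ 2) = e"
proof -
  obtain u v where uv: "u \<in> K" "v \<in> K" "u ^ 2 + v ^ 2 = e" by (rule sum_two_squares[OF assms(1)])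
  define y :: "nat \<Rightarrow> 'a" where "y = (\<lambda>i. if i = 1 then u else if i = 2 then v else 0)"
  have "(\<Sum>i=1..n. y i ^ 2) = (\<Sum>i\<in>{1, 2}. y i ^ 2)"
    by (rule sum.mono_neutral_right) (use assms in \<open>auto simp: y_def\<close>)
  also have "\<dots> = e" using uv by (simp add: y_def)
  finally show ?thesis using uv by (intro that[of y]) (auto simp: y_def)
qed

end

subsection \<open>Quadratic extensions\<close>

locale quadratic_extension = odd_subfield +
  assumes primepow_card: "primepow (card K)"
    and card_UNIV: "CARD('a) = card K ^ 2"
begin

text \<open>The characteristic divides the prime power \<open>card K\<close>, hence is its prime.
  Additivity of \<open>x \<mapsto> x ^ card K\<close> rests on this.\<close>

lemma card_eq_CHAR_power: obtains k where "card K = CHAR('a) ^ k"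
proof -
  obtain p k where p: "prime p" "card K = p ^ k"
    using primepow_card by (auto simp: primepow_def)
  have "CHAR('a) dvd p ^ k"
    using of_nat_card p by (metis of_nat_eq_0_iff_char_dvd)
  moreover have char: "prime CHAR('a)"
    by (rule prime_CHAR_semidom) (simp add: finite_imp_CHAR_pos)
  ultimately have "CHAR('a) = p"
    using p(1) by (meson prime_dvd_power primes_dvd_imp_eq)
  then show ?thesis using that p by blast
qed

lemma conj_add: "(x + y :: 'a) ^ card K = x ^ card K + y ^ card K"
proof -
  obtain k where "card K = CHAR('a) ^ k" by (rule card_eq_CHAR_power)
  moreover have "prime CHAR('a)"
    by (rule prime_CHAR_semidom) (simp add: finite_imp_CHAR_pos)
  ultimately show ?thesis by (metis freshmans_dream')
qed

lemma conj_uminus: "(- x :: 'a) ^ card K = - (x ^ card K)"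
  using odd_card by simp

lemma conj_diff: "(x - y :: 'a) ^ card K = x ^ card K - y ^ card K"
  using conj_add[of x "- y"] by (simp add: conj_uminus)

lemma conj_conj: "(x ^ card K :: 'a) ^ card K = x"
proof -
  \<comment> \<open>The whole field is a subfield of itself, so \<open>power_card\<close> applies
    with exponent \<open>card K ^ 2\<close>.\<close>
  interpret F: finite_subfield "UNIV :: 'a set"
    by unfold_locales (simp add: is_subfield_def)
  show ?thesis
    using F.power_card[of x] by (simp add: card_UNIV power_mult[symmetric] power2_eq_square)
qed

text \<open>The elements of \<open>K\<close> already exhaust the at most \<open>card K\<close> roots
  of \<open>x ^ card K - x\<close>.\<close>

lemma mem_iff_conj: "x \<in> K \<longleftrightarrow> x ^ card K = x"
proof -
  define p :: "'a poly" where "p = monom 1 (card K) + [:0, - 1:]"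
  have deg: "degree p = card K"
    unfolding p_def using card_gt_1 by (subst degree_add_eq_left) (auto simp: degree_monom_eq)
  then have "p \<noteq> 0" using card_gt_1 by auto
  from card_poly_roots_bound[OF this] have "card {x :: 'a. x ^ card K = x} \<le> card K"
    unfolding deg by (simp add: p_def poly_monom)
  moreover have "K \<subseteq> {x. x ^ card K = x}" using power_card by auto
  ultimately have "K = {x. x ^ card K = x}" by (intro card_seteq) auto
  then show ?thesis by blast
qed

end

text \<open>\<open>A\<close> is purely imaginary, so \<open>tr\<close> is a \<open>K\<close>-linear form with kernel \<open>K\<close>.\<close>
locale imaginary_element = quadratic_extension +
  fixes A :: 'a
  assumes A_neq_0: "A \<noteq> 0" and conj_A: "A ^ card K = - A"
begin

definition tr :: "'a \<Rightarrow> 'a" where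
  "tr z = (z ^ card K - z) / A"

lemma tr_mem [simp, intro]: "tr z \<in> K"
  using A_neq_0 unfolding mem_iff_conj tr_def
  by (simp add: power_divide conj_diff conj_conj conj_A field_simps)

lemma tr_add: "tr (x + y) = tr x + tr y"
  by (simp add: tr_def conj_add add_divide_distrib diff_divide_distrib)

lemma tr_diff: "tr (x - y) = tr x - tr y"
  by (simp add: tr_def conj_diff diff_divide_distrib)

lemma tr_scale: "s \<in> K \<Longrightarrow> tr (s * x) = s * tr x"
  by (simp add: tr_def power_mult_distrib power_card algebra_simps diff_divide_distrib)

lemma tr_eq_0_iff: "tr z = 0 \<longleftrightarrow> z \<in> K"
  using A_neq_0 by (simp add: tr_def mem_iff_conj)

lemma tr_sum: "tr (sum f I) = (\<Sum>i\<in>I. tr (f i))"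
proof (induction I rule: infinite_finite_induct)
  case empty
  show ?case using tr_eq_0_iff[of 0] by simp
next
  case (infinite I)
  then show ?case using tr_eq_0_iff[of 0] by simp
qed (simp add: tr_add)

text \<open>The fibre through \<open>w\<close> is the coset of the kernel \<open>K\<close>
  containing \<open>w\<close>.\<close>

lemma card_tr_fibre_tr: "card {z. tr z = tr w} = card K"
proof -
  have "tr z = tr w \<longleftrightarrow> z - w \<in> K" for z
    using tr_eq_0_iff[of "z - w"] by (simp add: tr_diff)
  then have "{z. tr z = tr w} = {z. z - w \<in> K}" by simp
  also have "\<dots> = (\<lambda>k. k + w) ` K"
  proof (intro equalityI subsetI)
    fix z assume "z \<in> {z. z - w \<in> K}"
    then show "z \<in> (\<lambda>k. k + w) ` K" by (intro image_eqI[of _ _ "z - w"]) auto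
  qed auto
  finally have "{z. tr z = tr w} = (\<lambda>k. k + w) ` K" .
  then show ?thesis by (simp add: card_image)
qed

text \<open>All nonempty fibres have \<open>card K\<close> elements and together fill
  \<open>card K ^ 2\<close> elements, so there are \<open>card K\<close> of them.\<close>

lemma range_tr: "range tr = K"
proof (rule card_seteq)
  have "CARD('a) = (\<Sum>v\<in>range tr. card {z \<in> UNIV. tr z = v})"
    by (rule card_eq_sum_fibres) auto
  also have "\<dots> = (\<Sum>v\<in>range tr. card K)"
    by (rule sum.cong) (auto simp: card_tr_fibre_tr)
  finally show "card K \<le> card (range tr)"
    using card_gt_0 by (auto simp: card_UNIV power2_eq_square)
qed auto

lemma tr_surj: assumes "k \<in> K" obtains z where "tr z = k"
proof -
  have "k \<in> range tr" using assms range_tr by simp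
  then show ?thesis using that by blast
qed

lemma card_tr_fibre: "k \<in> K \<Longrightarrow> card {z. tr z = k} = card K"
  using card_tr_fibre_tr tr_surj by metis

lemma card_tr_mult_fibre:
  assumes "k \<in> K" "\<kappa> \<noteq> 0"
  shows "card {x. tr (\<kappa> * x) = k} = card K"
proof -
  have "bij_betw ((*) \<kappa>) {x. tr (\<kappa> * x) = k} {z. tr z = k}"
    by (rule bij_betw_byWitness[of _ "\<lambda>z. z / \<kappa>"]) (use assms in auto)
  then show ?thesis using card_tr_fibre[OF assms(1)] by (simp add: bij_betw_same_card)
qed

lemma card_affine_points: "finite I \<Longrightarrow> card (I \<rightarrow>\<^sub>E (UNIV :: 'a set)) = card K ^ (2 * card I)"
  by (simp add: card_PiE card_UNIV power_mult)

end

subsection \<open>Hyperplane sections\<close>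

lemma sum_fun_upd:
  fixes g :: "nat \<Rightarrow> 'b \<Rightarrow> 'c::ab_group_add"
  assumes "j \<in> {1..n}"
  shows "(\<Sum>i=1..n. g i ((y(j := z)) i)) = (\<Sum>i=1..n. g i (y i)) - g j (y j) + g j z"
proof -
  have "(\<Sum>i=1..n. g i ((y(j := z)) i)) = g j z + (\<Sum>i\<in>{1..n} - {j}. g i (y i))"
    using assms by (subst sum.remove[of _ j]) (auto intro!: sum.cong)
  moreover have "(\<Sum>i=1..n. g i (y i)) = g j (y j) + (\<Sum>i\<in>{1..n} - {j}. g i (y i))"
    using assms by (intro sum.remove) auto
  ultimately show ?thesis by simp
qed

locale quadric_section = imaginary_element +
  fixes \<kappa> :: 'a
  assumes kappa_neq_0: "\<kappa> \<noteq> 0"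
begin

text \<open>Here \<open>n\<close> is \<open>r - 1\<close>, the number of coordinates that enter
  quadratically.\<close>

definition B :: "nat \<Rightarrow> (nat \<Rightarrow> 'a) set" where
  "B n = {x \<in> AG (Suc n). tr (x (Suc n)) = (\<Sum>i=1..n. tr (\<kappa> * x i) ^ 2)}"

lemma finite_AG: "finite (AG m :: (nat \<Rightarrow> 'a) set)"
  by (simp add: AG_def finite_PiE)

lemma finite_B: "finite (B n)"
  by (rule finite_subset[OF _ finite_AG]) (auto simp: B_def)

lemma card_B_Collect:
  assumes "\<And>y u. P (y(Suc n := u)) = Q y u"
  shows "card {x \<in> B n. P x} = (\<Sum>y\<in>{1..n} \<rightarrow>\<^sub>E UNIV.
    card {u. Q y u \<and> tr u = (\<Sum>i=1..n. tr (\<kappa> * y i) ^ 2)})"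
proof -
  let ?R = "\<lambda>x. P x \<and> tr (x (Suc n)) = (\<Sum>i=1..n. tr (\<kappa> * x i) ^ 2)"
  have I: "{1..Suc n} = insert (Suc n) {1..n}" by auto
  have "card {x \<in> B n. P x} = card {x \<in> Pi\<^sub>E (insert (Suc n) {1..n}) (\<lambda>_. UNIV). ?R x}"
    unfolding B_def AG_def I by (rule arg_cong[where f = card]) blast
  also have "\<dots> = (\<Sum>u\<in>UNIV. card {y \<in> {1..n} \<rightarrow>\<^sub>E UNIV. ?R (y(Suc n := u))})"
    by (rule card_PiE_insert_Collect) auto
  also have "\<dots> = (\<Sum>y\<in>{1..n} \<rightarrow>\<^sub>E UNIV. card {u \<in> UNIV. ?R (y(Suc n := u))})"
    by (rule sum_card_swap) (auto simp: finite_PiE)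
  also have "\<dots> = (\<Sum>y\<in>{1..n} \<rightarrow>\<^sub>E UNIV.
      card {u. Q y u \<and> tr u = (\<Sum>i=1..n. tr (\<kappa> * y i) ^ 2)})"
    by (intro sum.cong refl arg_cong[where f = card] Collect_cong) (auto simp: assms)
  finally show ?thesis .
qed

section \<open>Sizes of \<open>B\<close> and of its hyperplane sections\<close>

lemma sum_squares_mem: "(\<Sum>i\<in>I. tr (\<kappa> * y i) ^ 2) \<in> K"
  by (intro sum_mem) auto

lemma card_B: "card (B n) = card K ^ (2 * n + 1)"
proof -
  have "card (B n) = card {x \<in> B n. True}" by simp
  also have "\<dots> = (\<Sum>y\<in>{1..n} \<rightarrow>\<^sub>E (UNIV :: 'a set). card K)"
    by (subst card_B_Collect[where Q = "\<lambda>_ _. True"])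
      (auto simp: card_tr_fibre sum_squares_mem)
  finally show ?thesis by (simp add: card_affine_points)
qed

text \<open>This treats hyperplanes parallel to the last axis. The factor \<open>card K\<close> on
  the left counts the points of \<open>B n\<close> above each \<open>y\<close>. Moving coordinate
  \<open>j\<close> alone reaches every value of the linear form.\<close>

lemma card_linear_section:
  assumes "j \<in> {1..n}" "c j \<noteq> (0 :: 'a)"
  shows "card K * card {y \<in> {1..n} \<rightarrow>\<^sub>E UNIV. (\<Sum>i=1..n. c i * y i) = d} = card K ^ (2 * n - 1)"
proof -
  let ?S = "{1..n} \<rightarrow>\<^sub>E (UNIV :: 'a set)"
  have "CARD('a) * card {y \<in> ?S. (\<Sum>i=1..n. c i * y i) = d} = card ?S"
  proof (rule card_equidistributed)
    fix u v :: 'a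
    let ?h = "\<lambda>y. y(j := y j + (v - u) / c j)"
    have "inj ?h" by (rule injI) (metis add_right_cancel fun_upd_idem_iff fun_upd_same fun_upd_upd)
    moreover have "\<forall>y\<in>?S. (\<Sum>i=1..n. c i * y i) = u \<longrightarrow> ?h y \<in> ?S \<and> (\<Sum>i=1..n. c i * ?h y i) = v"
    proof (intro ballI impI conjI)
      fix y assume y: "y \<in> ?S" "(\<Sum>i=1..n. c i * y i) = u"
      show "?h y \<in> ?S" using y assms by (auto simp: PiE_def extensional_def)
      show "(\<Sum>i=1..n. c i * ?h y i) = v"
        using y(2) assms(2) by (subst sum_fun_upd[OF assms(1)]) (simp add: distrib_left)
    qed
    ultimately show "\<exists>h. inj_on h ?S \<and> (\<forall>y\<in>?S. (\<Sum>i=1..n. c i * y i) = u \<longrightarrow>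
        h y \<in> ?S \<and> (\<Sum>i=1..n. c i * h y i) = v)"
      by (intro exI[of _ ?h]) (auto intro: inj_on_subset)
  qed (auto simp: finite_PiE)
  moreover have "card K ^ (2 * n) = card K * card K ^ (2 * n - 1)"
    using assms(1) by (cases n) auto
  ultimately show ?thesis
    using card_gt_0 by (simp add: card_UNIV card_affine_points power2_eq_square)
qed

lemma card_oblique_section:
  assumes j: "j \<in> {1..n}" and c: "c j / \<kappa> \<notin> K" and "e \<in> K"
  shows "card {y \<in> {1..n} \<rightarrow>\<^sub>E UNIV. (\<Sum>i=1..n. tr (\<kappa> * y i) ^ 2 + tr (c i * y i)) = e} =
    card K ^ (2 * n - 1)"
proof -
  let ?S = "{1..n} \<rightarrow>\<^sub>E (UNIV :: 'a set)"
  let ?G = "\<lambda>y. \<Sum>i=1..n. tr (\<kappa> * y i) ^ 2 + tr (c i * y i)"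
  define t where "t = tr (c j / \<kappa>)"
  have t: "t \<in> K" "t \<noteq> 0" using c tr_eq_0_iff by (auto simp: t_def)
  have "card K * card {y \<in> ?S. ?G y = e} = card ?S"
  proof (rule card_equidistributed)
    fix u v assume uv: "u \<in> K" "v \<in> K"
    \<comment> \<open>Adding \<open>s / \<kappa>\<close> to coordinate \<open>j\<close> preserves
      its square term, as \<open>tr s = 0\<close>, and changes the linear term by
      \<open>s * t = v - u\<close>.\<close>
    define s where "s = (v - u) / t"
    have s: "s \<in> K" using uv t by (simp add: s_def)
    let ?h = "\<lambda>y. y(j := y j + s / \<kappa>)"
    have "inj ?h" by (rule injI) (metis add_right_cancel fun_upd_idem_iff fun_upd_same fun_upd_upd)
    moreover have "\<forall>y\<in>?S. ?G y = u \<longrightarrow> ?h y \<in> ?S \<and> ?G (?h y) = v"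
    proof (intro ballI impI conjI)
      fix y assume y: "y \<in> ?S" "?G y = u"
      show "?h y \<in> ?S" using y j by (auto simp: PiE_def extensional_def)
      have "tr (\<kappa> * (y j + s / \<kappa>)) = tr (\<kappa> * y j)"
        using s kappa_neq_0 tr_eq_0_iff[of s] by (simp add: distrib_left tr_add)
      moreover have "tr (c j * (y j + s / \<kappa>)) = tr (c j * y j) + s * t"
        using tr_scale[OF s, of "c j / \<kappa>"] by (simp add: distrib_left tr_add t_def mult.commute)
      ultimately show "?G (?h y) = v"
        using y(2) t(2)
        by (subst sum_fun_upd[OF j, of "\<lambda>i z. tr (\<kappa> * z) ^ 2 + tr (c i * z)"]) (simp add: s_def)
    qed
    ultimately show "\<exists>h. inj_on h ?S \<and> (\<forall>y\<in>?S. ?G y = u \<longrightarrow> h y \<in> ?S \<and> ?G (h y) = v)"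
      by (intro exI[of _ ?h]) (auto intro: inj_on_subset)
  qed (use assms(3) in \<open>auto simp: finite_PiE intro!: sum_mem\<close>)
  moreover have "card K ^ (2 * n) = card K * card K ^ (2 * n - 1)"
    using j by (cases n) auto
  ultimately show ?thesis
    using card_gt_0 by (simp add: card_affine_points)
qed

text \<open>The map \<open>\<Phi>\<close> sends the affine points onto the tuples over
  \<open>K\<close>; each of its fibres is a product of \<open>n\<close> fibres of
  \<open>tr (\<kappa> * x)\<close>, of size \<open>card K\<close> each.\<close>

lemma card_shifted_squares:
  assumes "\<And>i. i \<in> {1..n} \<Longrightarrow> \<beta> i \<in> K"
  shows "card {y \<in> {1..n} \<rightarrow>\<^sub>E UNIV. (\<Sum>i=1..n. (tr (\<kappa> * y i) + \<beta> i) ^ 2) = e} =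
    card K ^ n * sqsum n e"
proof -
  let ?S = "{y \<in> {1..n} \<rightarrow>\<^sub>E UNIV. (\<Sum>i=1..n. (tr (\<kappa> * y i) + \<beta> i) ^ 2) = e}"
  let ?T = "{z \<in> {1..n} \<rightarrow>\<^sub>E K. (\<Sum>i=1..n. z i ^ 2) = e}"
  define \<Phi> where "\<Phi> = (\<lambda>y. \<lambda>i\<in>{1..n}. tr (\<kappa> * y i) + \<beta> i)"
  have "card ?S = (\<Sum>z\<in>?T. card {y \<in> ?S. \<Phi> y = z})"
    by (rule card_eq_sum_fibres) (use assms in \<open>auto simp: \<Phi>_def finite_PiE\<close>)
  also have "\<dots> = (\<Sum>z\<in>?T. card K ^ n)"
  proof (rule sum.cong)
    fix z assume z: "z \<in> ?T"
    have "{y \<in> ?S. \<Phi> y = z} = (\<Pi>\<^sub>E i\<in>{1..n}. {x. tr (\<kappa> * x) = z i - \<beta> i})"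
    proof (intro equalityI subsetI)
      fix y assume "y \<in> {y \<in> ?S. \<Phi> y = z}"
      then show "y \<in> (\<Pi>\<^sub>E i\<in>{1..n}. {x. tr (\<kappa> * x) = z i - \<beta> i})"
        by (auto simp: \<Phi>_def PiE_iff)
    next
      fix y assume y: "y \<in> (\<Pi>\<^sub>E i\<in>{1..n}. {x. tr (\<kappa> * x) = z i - \<beta> i})"
      then have yz: "tr (\<kappa> * y i) + \<beta> i = z i" if "i \<in> {1..n}" for i
        using that by (auto simp: PiE_iff)
      then have "\<Phi> y = z"
        using z by (auto simp: \<Phi>_def PiE_iff extensional_def)
      moreover have "(\<Sum>i=1..n. (tr (\<kappa> * y i) + \<beta> i) ^ 2) = (\<Sum>i=1..n. z i ^ 2)"
        by (rule sum.cong) (use yz in auto)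
      ultimately show "y \<in> {y \<in> ?S. \<Phi> y = z}"
        using z y by (auto simp: PiE_iff)
    qed
    then have "card {y \<in> ?S. \<Phi> y = z} = (\<Prod>i=1..n. card {x. tr (\<kappa> * x) = z i - \<beta> i})"
      by (simp add: card_PiE)
    also have "\<dots> = (\<Prod>i=1..n. card K)"
      by (rule prod.cong) (use z assms kappa_neq_0 in \<open>auto intro!: card_tr_mult_fibre simp: PiE_iff\<close>)
    finally show "card {y \<in> ?S. \<Phi> y = z} = card K ^ n" by simp
  qed simp
  finally show ?thesis by (simp add: sqsum_def)
qed

lemma card_graph_section:
  assumes "c (Suc n) = (1 :: 'a)"
  shows "card ({x \<in> AG (Suc n). (\<Sum>i=1..Suc n. c i * x i) = d} \<inter> B n) =
    card {y \<in> {1..n} \<rightarrow>\<^sub>E UNIV. (\<Sum>i=1..n. tr (\<kappa> * y i) ^ 2 + tr (c i * y i)) = tr d}"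
proof -
  have "{x \<in> AG (Suc n). (\<Sum>i=1..Suc n. c i * x i) = d} \<inter> B n =
      {x \<in> B n. (\<Sum>i=1..Suc n. c i * x i) = d}"
    by (auto simp: B_def)
  also have "card \<dots> = (\<Sum>y\<in>{1..n} \<rightarrow>\<^sub>E UNIV.
      card {u. u = d - (\<Sum>i=1..n. c i * y i) \<and> tr u = (\<Sum>i=1..n. tr (\<kappa> * y i) ^ 2)})"
    by (rule card_B_Collect) (auto simp: assms algebra_simps)
  also have "\<dots> = (\<Sum>y\<in>{1..n} \<rightarrow>\<^sub>E UNIV.
      if (\<Sum>i=1..n. tr (\<kappa> * y i) ^ 2 + tr (c i * y i)) = tr d then 1 else 0)"
  proof (rule sum.cong)
    fix y :: "nat \<Rightarrow> 'a"
    let ?u = "d - (\<Sum>i=1..n. c i * y i)"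
    have "tr ?u = (\<Sum>i=1..n. tr (\<kappa> * y i) ^ 2) \<longleftrightarrow>
        (\<Sum>i=1..n. tr (\<kappa> * y i) ^ 2 + tr (c i * y i)) = tr d"
      by (auto simp: tr_diff tr_sum sum.distrib algebra_simps)
    moreover have "{u. u = ?u \<and> tr u = s} = (if tr ?u = s then {?u} else {})" for s by auto
    ultimately show "card {u. u = ?u \<and> tr u = (\<Sum>i=1..n. tr (\<kappa> * y i) ^ 2)} =
        (if (\<Sum>i=1..n. tr (\<kappa> * y i) ^ 2 + tr (c i * y i)) = tr d then 1 else 0)"
      by simp
  qed simp
  also have "\<dots> = card {y \<in> {1..n} \<rightarrow>\<^sub>E UNIV.
      (\<Sum>i=1..n. tr (\<kappa> * y i) ^ 2 + tr (c i * y i)) = tr d}"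
    by (simp add: sum.If_cases finite_PiE Int_def)
  finally show ?thesis .
qed

text \<open>For \<open>\<beta> i\<close> in \<open>K\<close>, linearity of \<open>tr\<close> turns
  the linear term into \<open>2 * \<beta> i * tr (\<kappa> * y i)\<close>, so the square can be
  completed over \<open>K\<close>.\<close>

lemma card_tangent_section:
  assumes "c (Suc n) = 1" and \<beta>: "\<And>i. i \<in> {1..n} \<Longrightarrow> \<beta> i \<in> K \<and> c i = 2 * \<beta> i * \<kappa>"
  shows "card ({x \<in> AG (Suc n). (\<Sum>i=1..Suc n. c i * x i) = d} \<inter> B n) =
    card K ^ n * sqsum n (tr d + (\<Sum>i=1..n. \<beta> i ^ 2))"
proof -
  have two: "2 \<in> K" using add_mem[of 1 1] by simp
  have "tr (\<kappa> * y i) ^ 2 + tr (c i * y i) = (tr (\<kappa> * y i) + \<beta> i) ^ 2 - \<beta> i ^ 2"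
    if "i \<in> {1..n}" for i and y :: "nat \<Rightarrow> 'a"
  proof -
    have "tr (c i * y i) = 2 * \<beta> i * tr (\<kappa> * y i)"
      using \<beta>[OF that] tr_scale[of "2 * \<beta> i" "\<kappa> * y i"] two by (simp add: mult.assoc)
    then show ?thesis by (simp add: power2_sum)
  qed
  then have "(\<Sum>i=1..n. tr (\<kappa> * y i) ^ 2 + tr (c i * y i)) =
      (\<Sum>i=1..n. (tr (\<kappa> * y i) + \<beta> i) ^ 2) - (\<Sum>i=1..n. \<beta> i ^ 2)" for y :: "nat \<Rightarrow> 'a"
    by (simp flip: sum_subtractf)
  then show ?thesis
    unfolding card_graph_section[of c, OF assms(1)]
    using card_shifted_squares[of n \<beta> "tr d + (\<Sum>i=1..n. \<beta> i ^ 2)"] \<beta>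
    by (simp add: diff_eq_eq)
qed

lemma card_hyperplane_section:
  assumes "H \<in> hyperplanes (Suc n)" "n \<ge> 1"
  shows "card (H \<inter> B n) = card K ^ (2 * n - 1) \<or>
    (\<exists>e\<in>K. card (H \<inter> B n) = card K ^ n * sqsum n e)"
proof -
  obtain c d where c: "\<exists>i\<in>{1..Suc n}. c i \<noteq> 0"
    and H: "H = {x \<in> AG (Suc n). (\<Sum>i=1..Suc n. c i * x i) = d}"
    using assms(1) by (auto simp: hyperplanes_def)
  show ?thesis
  proof (cases "c (Suc n) = 0")
    case True
    then obtain j where j: "j \<in> {1..n}" "c j \<noteq> 0" using c by (auto simp: le_Suc_eq)
    have "H \<inter> B n = {x \<in> B n. (\<Sum>i=1..Suc n. c i * x i) = d}"
      by (auto simp: B_def H)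
    also have "card \<dots> = (\<Sum>y\<in>{1..n} \<rightarrow>\<^sub>E UNIV.
        card {u. (\<Sum>i=1..n. c i * y i) = d \<and> tr u = (\<Sum>i=1..n. tr (\<kappa> * y i) ^ 2)})"
      by (rule card_B_Collect) (simp add: True)
    also have "\<dots> = (\<Sum>y\<in>{1..n} \<rightarrow>\<^sub>E UNIV. if (\<Sum>i=1..n. c i * y i) = d then card K else 0)"
      by (rule sum.cong) (auto simp: card_tr_fibre sum_squares_mem)
    also have "\<dots> = card K * card {y \<in> {1..n} \<rightarrow>\<^sub>E UNIV. (\<Sum>i=1..n. c i * y i) = d}"
      by (simp add: sum.If_cases finite_PiE Int_def)
    also have "\<dots> = card K ^ (2 * n - 1)" by (rule card_linear_section[of j n c d, OF j])
    finally show ?thesis by blast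
  next
    case False
    \<comment> \<open>Scaling the last coefficient to 1 presents the hyperplane as a graph over the
      first \<open>n\<close> coordinates.\<close>
    define c' where "c' = (\<lambda>i. c i / c (Suc n))"
    have c': "c' (Suc n) = 1" using False by (simp add: c'_def)
    have "(\<Sum>i=1..Suc n. c' i * x i) = (\<Sum>i=1..Suc n. c i * x i) / c (Suc n)" for x
      unfolding sum_divide_distrib by (rule sum.cong) (auto simp: c'_def)
    then have H': "H = {x \<in> AG (Suc n). (\<Sum>i=1..Suc n. c' i * x i) = d / c (Suc n)}"
      using False unfolding H by (metis (no_types, lifting) divide_cancel_right)
    show ?thesis
    proof (cases "\<exists>j\<in>{1..n}. c' j / \<kappa> \<notin> K")
      case True
      then show ?thesis
        unfolding H' card_graph_section[of c', OF c'] using card_oblique_section by blast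
    next
      case False
      have two: "2 \<in> K" using add_mem[of 1 1] by simp
      define \<beta> where "\<beta> = (\<lambda>i. c' i / \<kappa> / 2)"
      have \<beta>: "\<beta> i \<in> K \<and> c' i = 2 * \<beta> i * \<kappa>" if "i \<in> {1..n}" for i
        using False that two kappa_neq_0 two_neq_0 unfolding \<beta>_def by (simp del: divide_divide_eq_left)
      have "tr (d / c (Suc n)) + (\<Sum>i=1..n. \<beta> i ^ 2) \<in> K"
        using \<beta> by (intro add_mem sum_mem power_mem) auto
      then show ?thesis
        using card_tangent_section[of c' n \<beta> "d / c (Suc n)", OF c' \<beta>] unfolding H' by blast
    qed
  qed
qed

lemma hyperplane_through_point:
  assumes P: "P \<in> B n" and "n \<ge> 2" "e \<in> K"
  obtains H where "H \<in> hyperplanes (Suc n)" "P \<in> H" "card (H \<inter> B n) = card K ^ n * sqsum n e"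
proof -
  obtain z where z: "\<And>i. z i \<in> K" "(\<Sum>i=1..n. z i ^ 2) = e"
    using sum_squares_surj[OF assms(3,2)] by metis
  \<comment> \<open>The slopes make the completed squares at \<open>P\<close> equal to
    \<open>z i ^ 2\<close>, whose sum is \<open>e\<close>; then \<open>d\<close> is fixed by passing
    through \<open>P\<close>.\<close>
  define \<beta> where "\<beta> = (\<lambda>i. z i - tr (\<kappa> * P i))"
  define c where "c = (\<lambda>i. if i = Suc n then 1 else 2 * \<beta> i * \<kappa>)"
  define d where "d = (\<Sum>i=1..Suc n. c i * P i)"
  define H where "H = {x \<in> AG (Suc n). (\<Sum>i=1..Suc n. c i * x i) = d}"
  have c: "c (Suc n) = 1" "\<And>i. i \<in> {1..n} \<Longrightarrow> \<beta> i \<in> K \<and> c i = 2 * \<beta> i * \<kappa>"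
    using z by (auto simp: c_def \<beta>_def)
  have two: "2 \<in> K" using add_mem[of 1 1] by simp
  have "tr d = tr (P (Suc n)) + (\<Sum>i=1..n. tr (2 * \<beta> i * \<kappa> * P i))"
    by (simp add: d_def tr_add tr_sum c_def add.commute)
  also have "(\<Sum>i=1..n. tr (2 * \<beta> i * \<kappa> * P i)) = (\<Sum>i=1..n. 2 * \<beta> i * tr (\<kappa> * P i))"
  proof (rule sum.cong)
    fix i assume "i \<in> {1..n}"
    then show "tr (2 * \<beta> i * \<kappa> * P i) = 2 * \<beta> i * tr (\<kappa> * P i)"
      using c(2) two tr_scale[of "2 * \<beta> i" "\<kappa> * P i"] by (simp add: mult.assoc)
  qed simp
  also have "tr (P (Suc n)) = (\<Sum>i=1..n. tr (\<kappa> * P i) ^ 2)" using P by (simp add: B_def)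
  finally have "tr d + (\<Sum>i=1..n. \<beta> i ^ 2) =
      (\<Sum>i=1..n. tr (\<kappa> * P i) ^ 2 + 2 * \<beta> i * tr (\<kappa> * P i) + \<beta> i ^ 2)"
    by (simp add: sum.distrib)
  also have "\<dots> = e"
    unfolding z(2)[symmetric]
    by (rule sum.cong) (auto simp: \<beta>_def power2_eq_square algebra_simps)
  finally have "card (H \<inter> B n) = card K ^ n * sqsum n e"
    unfolding H_def using card_tangent_section[of c n \<beta>, OF c] by simp
  moreover have "H \<in> hyperplanes (Suc n)"
    unfolding H_def hyperplanes_def using c(1) by (intro CollectI exI[of _ c] exI[of _ d] conjI bexI[of _ "Suc n"] refl) auto
  moreover have "P \<in> H" using P by (auto simp: H_def d_def B_def)
  ultimately show ?thesis using that by blast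
qed

text \<open>Every point lies on a hyperplane that attains the minimum \<open>t\<close>; deleting the
  point leaves fewer than \<open>t\<close> points there.\<close>

lemma minimal_B:
  assumes n: "n \<ge> 2"
  shows "minimal_intersection_set (Suc n) (Min (intersection_numbers (Suc n) (B n))) (B n)"
proof -
  obtain e where e: "e \<in> K" and e_min: "\<And>f. f \<in> K \<Longrightarrow> sqsum n e \<le> sqsum n f"
    using ex_is_arg_min_if_finite[of K "sqsum n"] by (auto simp: is_arg_min_linorder)
  define t where "t = card K ^ n * sqsum n e"
  \<comment> \<open>The least value is at most the mean, so the sections of size
    \<open>card K ^ (2 * n - 1)\<close> cannot fall below \<open>t\<close>.\<close>
  have "card K * sqsum n e \<le> (\<Sum>f\<in>K. sqsum n f)"
    using sum_mono[of K "\<lambda>_. sqsum n e" "sqsum n"] e_min by simp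
  also have "\<dots> = card K * card K ^ (n - 1)"
    using n by (cases n) (auto simp: sum_sqsum)
  finally have "sqsum n e \<le> card K ^ (n - 1)" using card_gt_0 by simp
  then have "t \<le> card K ^ n * card K ^ (n - 1)" by (simp add: t_def)
  also have "\<dots> = card K ^ (2 * n - 1)"
    using n by (cases n) (auto simp: power_add[symmetric] mult_2)
  finally have t_le: "t \<le> card K ^ (2 * n - 1)" .
  have lower: "t \<le> card (H \<inter> B n)" if "H \<in> hyperplanes (Suc n)" for H
    using card_hyperplane_section[OF that] n t_le e_min by (auto simp: t_def)
  have through: "\<exists>H\<in>hyperplanes (Suc n). P \<in> H \<and> card (H \<inter> B n) = t" if "P \<in> B n" for P
    using hyperplane_through_point[OF that n e] unfolding t_def by metis
  obtain z where "\<And>i. z i \<in> K" "(\<Sum>i=1..n. z i ^ 2) = e"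
    using sum_squares_surj[OF e n] by metis
  then have "(\<lambda>i\<in>{1..n}. z i) \<in> {y \<in> {1..n} \<rightarrow>\<^sub>E K. (\<Sum>i=1..n. y i ^ 2) = e}" by auto
  then have "sqsum n e > 0" unfolding sqsum_def card_gt_0_iff by (intro conjI) (blast, simp add: finite_PiE)
  then have t_pos: "t > 0" using card_gt_0 by (simp add: t_def)
  have "card (B n) > 0" using card_gt_0 by (simp add: card_B)
  then obtain P where "P \<in> B n" by (auto simp: card_gt_0_iff)
  then obtain H where "H \<in> hyperplanes (Suc n)" "card (H \<inter> B n) = t" using through by blast
  moreover have "intersection_numbers (Suc n) (B n) \<subseteq> {..card (B n)}"
    using finite_B by (auto simp: intersection_numbers_def intro: card_mono)
  then have "finite (intersection_numbers (Suc n) (B n))" by (rule finite_subset) simp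
  ultimately have Min: "Min (intersection_numbers (Suc n) (B n)) = t"
    using lower by (intro Min_eqI) (auto simp: intersection_numbers_def)
  have "\<not> intersection_set (Suc n) t (B n - {P})" if P: "P \<in> B n" for P
  proof
    assume int: "intersection_set (Suc n) t (B n - {P})"
    obtain H where H: "H \<in> hyperplanes (Suc n)" "P \<in> H" "card (H \<inter> B n) = t"
      using through[OF P] by blast
    have "card (H \<inter> (B n - {P})) < card (H \<inter> B n)"
      using H P finite_B by (intro psubset_card_mono) auto
    then show False using int H by (auto simp: intersection_set_def)
  qed
  then show ?thesis
    unfolding Min minimal_intersection_set_def essential_def intersection_set_def[of _ _ "B n"]
    using t_pos lower by (auto simp: B_def)
qed

end

subsection \<open>The normal form of \<open>BB\<close>\<close>

context quadratic_extension
begin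

text \<open>The discriminant condition makes \<open>a * x ^ 2 + \<delta> * x ^ (card K + 1) - a ^
  card K * x ^ (2 * card K)\<close> equal to \<open>a * L x ^ 2\<close>, and all values of
  \<open>L\<close> lie on one line over \<open>K\<close>.\<close>

lemma BB_normal_form:
  fixes a b :: 'a
  assumes a: "a \<noteq> 0" and b: "b \<notin> K" and disc: "4 * a ^ (card K + 1) + (b ^ card K - b) ^ 2 = 0"
  obtains A \<kappa> where "quadric_section K A \<kappa>"
    "\<And>n. BB (card K) (Suc n) a b = quadric_section.B K A \<kappa> n"
proof -
  define \<delta> where "\<delta> = b ^ card K - b"
  define c where "c = \<delta> / (2 * a)"
  define L where "L = (\<lambda>x. x + c * x ^ card K)"
  have conj_2: "2 ^ card K = (2 :: 'a)" using power_card[of 2] add_mem[of 1 1] by simp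
  have "\<delta> ^ 2 = - (4 * a ^ (card K + 1))" using disc by (simp add: \<delta>_def eq_neg_iff_add_eq_0 add.commute)
  moreover have "(4 :: 'a) \<noteq> 0" using two_neq_0 no_zero_divisors[of "2 :: 'a" 2] by simp
  ultimately have c2: "a * c ^ 2 = - (a ^ card K)"
    using a by (simp add: c_def power_divide power_mult_distrib power2_eq_square field_simps)
  have dc: "\<delta> = 2 * a * c" using a two_neq_0 by (simp add: c_def)
  have "c ^ card K = - \<delta> / (2 * a ^ card K)"
    by (simp add: c_def power_divide power_mult_distrib conj_2 \<delta>_def conj_diff conj_conj)
  then have conj_ca: "c ^ card K * (a ^ card K) = - (a * c)"
    using a two_neq_0 dc by (simp add: field_simps)
  have "a * c * (c * c ^ card K) = a * c ^ 2 * c ^ card K"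
    by (simp add: power2_eq_square mult_ac)
  also have "\<dots> = a * c" unfolding c2 using conj_ca by (simp add: mult.commute)
  finally have "a * c * (c * c ^ card K) = a * c" .
  moreover have "c \<noteq> 0" using c2 a by auto
  ultimately have cc: "c * c ^ card K = 1" using a by simp
  \<comment> \<open>Consequently the quotient of two values of \<open>L\<close> with nonzero
    denominator is fixed by conjugation.\<close>
  have conj_L: "c * L x ^ card K = L x" for x
    using cc by (simp add: L_def conj_add power_mult_distrib conj_conj algebra_simps)
  \<comment> \<open>If \<open>L\<close> vanished at 1, then \<open>c = - 1\<close>, and
    \<open>L b = b - b ^ card K\<close> is nonzero because \<open>b\<close> is outside
    \<open>K\<close>.\<close>
  have "\<exists>x. L x \<noteq> 0"
  proof (rule ccontr)
    assume "\<nexists>x. L x \<noteq> 0"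
    then have "L 1 = 0" "L b = 0" by auto
    then have c: "c = - 1" by (simp add: L_def eq_neg_iff_add_eq_0 add.commute)
    then have "b ^ card K = b" using \<open>L b = 0\<close> by (simp add: L_def)
    then show False using b mem_iff_conj by blast
  qed
  then obtain x0 where x0: "L x0 \<noteq> 0" by blast
  define l where "l = L x0"
  \<comment> \<open>Dividing by the fixed value \<open>l\<close> gives
    \<open>a * L x ^ 2 = A * (L x / l) ^ 2\<close>; \<open>\<kappa>\<close> is chosen so that
    \<open>tr (\<kappa> * x) = L x / l\<close>.\<close>
  define A where "A = a * l ^ 2"
  define \<kappa> where "\<kappa> = - (a * l)"
  have l: "l \<noteq> 0" "c * l ^ card K = l" using x0 conj_L by (auto simp: l_def)
  have "A ^ card K = a ^ card K * (l ^ card K) ^ 2"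
    by (simp add: A_def power_mult_distrib power_mult[symmetric] mult.commute)
  also have "a ^ card K = - (a * c ^ 2)" using c2 by simp
  also have "- (a * c ^ 2) * (l ^ card K) ^ 2 = - (a * (c * l ^ card K) ^ 2)"
    by (simp add: power_mult_distrib)
  finally have conj_A: "A ^ card K = - A" using l by (simp add: A_def)
  interpret quadric_section K A \<kappa>
    by unfold_locales (use a l conj_A in \<open>auto simp: A_def \<kappa>_def\<close>)
  have conj_kappa: "\<kappa> ^ card K = a * c * l"
  proof -
    have "\<kappa> ^ card K = - (a ^ card K * l ^ card K)"
      by (simp add: \<kappa>_def conj_uminus power_mult_distrib)
    also have "\<dots> = a * c ^ 2 * l ^ card K" using c2 by simp
    also have "\<dots> = a * c * (c * l ^ card K)" by (simp add: power2_eq_square)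
    finally show ?thesis using l by simp
  qed
  have tr_kappa: "tr (\<kappa> * x) = L x / l" for x
  proof -
    have "tr (\<kappa> * x) = (a * c * l * x ^ card K - \<kappa> * x) / A"
      by (simp add: tr_def power_mult_distrib conj_kappa)
    also have "\<dots> = a * l * L x / (a * l * l)"
      by (simp add: \<kappa>_def A_def L_def algebra_simps power2_eq_square)
    finally show ?thesis using l a by simp
  qed
  have square: "A * tr (\<kappa> * x) ^ 2 = a * x ^ 2 + \<delta> * x ^ (card K + 1) - a ^ card K * x ^ (2 * card K)" for x
  proof -
    have "A * tr (\<kappa> * x) ^ 2 = a * L x ^ 2"
      unfolding tr_kappa using l by (simp add: A_def power_divide)
    also have "\<dots> = a * x ^ 2 + 2 * a * c * (x * x ^ card K) + (a * c ^ 2) * (x ^ card K) ^ 2"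
      by (simp add: L_def power2_eq_square algebra_simps)
    finally show ?thesis
      by (simp add: c2 dc power_mult[symmetric] mult.commute)
  qed
  have "BB (card K) (Suc n) a b = B n" for n
  proof -
    have "x (Suc n) ^ card K - x (Suc n) + a ^ card K * (\<Sum>i=1..n. x i ^ (2 * card K)) - a * (\<Sum>i=1..n. x i ^ 2)
        = \<delta> * (\<Sum>i=1..n. x i ^ (card K + 1)) \<longleftrightarrow> tr (x (Suc n)) = (\<Sum>i=1..n. tr (\<kappa> * x i) ^ 2)"
      for x :: "nat \<Rightarrow> 'a"
    proof -
      have "tr (x (Suc n)) = (\<Sum>i=1..n. tr (\<kappa> * x i) ^ 2) \<longleftrightarrow>
          x (Suc n) ^ card K - x (Suc n) = A * (\<Sum>i=1..n. tr (\<kappa> * x i) ^ 2)"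
        using A_neq_0 by (simp add: tr_def divide_eq_eq mult.commute)
      also have "A * (\<Sum>i=1..n. tr (\<kappa> * x i) ^ 2) = a * (\<Sum>i=1..n. x i ^ 2)
          + \<delta> * (\<Sum>i=1..n. x i ^ (card K + 1)) - a ^ card K * (\<Sum>i=1..n. x i ^ (2 * card K))"
        unfolding sum_distrib_left square by (simp only: sum.distrib sum_subtractf)
      finally show ?thesis by (auto simp: algebra_simps)
    qed
    then show ?thesis by (simp add: BB_def B_def \<delta>_def)
  qed
  then show ?thesis using that quadric_section_axioms by blast
qed

end

section \<open>From section sizes to the three cases for \<open>r\<close> and
  \<open>q\<close>\<close>

theorem theorem3p1:
  fixes q r :: nat and K :: "'a::{field,finite} set" and a b :: 'a
  assumes "primepow q" and "odd q" and "r \<ge> 2"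
    and "CARD('a) = q ^ 2"
    and "is_subfield K" and "card K = q"
    and "a \<noteq> 0" and "b \<notin> K"
    and "4 * a ^ (q + 1) + (b ^ q - b) ^ 2 = 0"
  shows "card (BB q r a b) = q ^ (2 * r - 1) \<and>
    (r mod 4 = 1 \<or> odd r \<and> q mod 4 = 1 \<longrightarrow>
      (\<forall>H \<in> hyperplanes r. int (card (H \<inter> BB q r a b)) \<in>
        {int q ^ (2 * r - 3) - int q ^ ((3 * r - 5) div 2),
         int q ^ (2 * r - 3),
         int q ^ (2 * r - 3) - int q ^ ((3 * r - 5) div 2) + int q ^ ((3 * (r - 1)) div 2)})) \<and>
    (r mod 4 = 3 \<and> q mod 4 = 3 \<longrightarrow>
      (\<forall>H \<in> hyperplanes r. int (card (H \<inter> BB q r a b)) \<in>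
        {int q ^ (2 * r - 3) + int q ^ ((3 * r - 5) div 2) - int q ^ ((3 * (r - 1)) div 2),
         int q ^ (2 * r - 3),
         int q ^ (2 * r - 3) + int q ^ ((3 * r - 5) div 2)})) \<and>
    (even r \<longrightarrow>
      (\<forall>H \<in> hyperplanes r. int (card (H \<inter> BB q r a b)) \<in>
        {int q ^ (2 * r - 3) - int q ^ ((3 * r - 4) div 2),
         int q ^ (2 * r - 3),
         int q ^ (2 * r - 3) + int q ^ ((3 * r - 4) div 2)})) \<and>
    (r > 2 \<longrightarrow>
      minimal_intersection_set r (Min (intersection_numbers r (BB q r a b))) (BB q r a b))"
proof -
  interpret quadratic_extension K
    by unfold_locales (use assms in auto)
  note q = \<open>card K = q\<close>
  obtain A \<kappa> where sec: "quadric_section K A \<kappa>"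
    and BB: "\<And>n. BB (card K) (Suc n) a b = quadric_section.B K A \<kappa> n"
    by (rule BB_normal_form[of a b]) (use assms in auto)
  interpret quadric_section K A \<kappa> by (rule sec)
  define n where "n = r - 1"
  have r: "r = Suc n" "n \<ge> 1" using assms by (auto simp: n_def)
  have BB: "BB q r a b = B n" using BB q r by simp
  \<comment> \<open>The sign \<open>s\<close> treats both cases of odd \<open>r\<close> at once. The
    second alternative comes from representing 0, the third from representing a nonzero
    element.\<close>
  have odd_case: "int (card (H \<inter> B n)) = int q ^ (2 * r - 3) \<or>
      int (card (H \<inter> B n)) = int q ^ (2 * r - 3) +
        s * (int q ^ ((3 * (r - 1)) div 2) - int q ^ ((3 * r - 5) div 2)) \<or>
      int (card (H \<inter> B n)) = int q ^ (2 * r - 3) - s * int q ^ ((3 * r - 5) div 2)"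
    if H: "H \<in> hyperplanes r" and "odd r" and s: "\<sigma> ^ ((r - 1) div 2) = s" for H s
  proof -
    define k where "k = (r - 3) div 2"
    have k: "r = 2 * k + 3" using \<open>odd r\<close> assms(3) unfolding k_def by (elim oddE) auto
    have nk: "n = 2 * k + 2" using k r by simp
    have e: "2 * r - 3 = 4 * k + 3" "(3 * (r - 1)) div 2 = 3 * k + 3" "(3 * r - 5) div 2 = 3 * k + 2"
      "(r - 1) div 2 = k + 1" "2 * n - 1 = 4 * k + 3"
      using k nk by auto
    from card_hyperplane_section[OF H[unfolded r(1)] r(2)] show ?thesis
    proof
      assume "\<exists>e\<in>K. card (H \<inter> B n) = card K ^ n * sqsum n e"
      then obtain f where f: "f \<in> K" "card (H \<inter> B n) = card K ^ n * sqsum n f" by blast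
      have s': "\<sigma> ^ (k + 1) = s" using s e by simp
      have "int (card (H \<inter> B n)) = int q ^ (2 * k + 2) * int (sqsum (2 * k + 2) f)"
        using f(2) unfolding q nk by simp
      also have "\<dots> = int q ^ (4 * k + 3) +
          s * (if f = 0 then int q ^ (3 * k + 3) - int q ^ (3 * k + 2) else - (int q ^ (3 * k + 2)))"
        unfolding sqsum_even[OF f(1)] q s'
        by (simp add: algebra_simps flip: power_add) (simp add: algebra_simps power_add power_mult power2_eq_square numeral_eq_Suc)
      finally show ?thesis unfolding e by (simp split: if_splits)
    qed (unfold e q, simp)
  qed
  have even_case: "int (card (H \<inter> B n)) \<in> {int q ^ (2 * r - 3) - int q ^ ((3 * r - 4) div 2),
      int q ^ (2 * r - 3), int q ^ (2 * r - 3) + int q ^ ((3 * r - 4) div 2)}"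
    if H: "H \<in> hyperplanes r" and "even r" for H
  proof -
    define k where "k = (r - 2) div 2"
    have k: "r = 2 * k + 2" using \<open>even r\<close> assms(3) unfolding k_def by (elim evenE) auto
    have nk: "n = 2 * k + 1" using k r by simp
    have e: "2 * r - 3 = 4 * k + 1" "(3 * r - 4) div 2 = 3 * k + 1" "2 * n - 1 = 4 * k + 1"
      using k nk by auto
    from card_hyperplane_section[OF H[unfolded r(1)] r(2)] show ?thesis
    proof
      assume "\<exists>e\<in>K. card (H \<inter> B n) = card K ^ n * sqsum n e"
      then obtain f where f: "f \<in> K" "card (H \<inter> B n) = card K ^ n * sqsum n f" by blast
      \<comment> \<open>For even \<open>r\<close> the number of squares is odd, and this deviation
        from the mean takes only three values.\<close>
      define D where "D = int (sqsum (2 * k + 1) f) - int q ^ (2 * k)"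
      have D: "D \<in> {- (int q ^ k), 0, int q ^ k}"
        using sqsum_odd[OF f(1), of k] unfolding D_def q .
      have "int (card (H \<inter> B n)) = int q ^ (2 * k + 1) * (int q ^ (2 * k) + D)"
        using f(2) unfolding q nk D_def by simp
      also have "\<dots> = int q ^ (4 * k + 1) + int q ^ (2 * k + 1) * D"
        by (simp add: distrib_left flip: power_add)
      finally have "int (card (H \<inter> B n)) = int q ^ (4 * k + 1) + int q ^ (2 * k + 1) * D" .
      moreover have "int q ^ (2 * k + 1) * int q ^ k = int q ^ (3 * k + 1)"
        by (simp flip: power_add)
      ultimately show ?thesis using D unfolding e by auto
    qed (unfold e q, simp)
  qed
  have sigma: "\<sigma> = 1 \<or> \<sigma> = - 1" by (simp add: \<sigma>_def)
  \<comment> \<open>Either \<open>\<sigma>\<close> itself is 1 or the exponent is even.\<close>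
  have s1: "\<sigma> ^ ((r - 1) div 2) = 1" if "r mod 4 = 1 \<or> odd r \<and> q mod 4 = 1"
  proof (cases "q mod 4 = 1")
    case True
    then show ?thesis using sigma_eq_1 q by simp
  next
    case False
    then have "even ((r - 1) div 2)" using that by presburger
    then show ?thesis using sigma by auto
  qed
  have s2: "\<sigma> ^ ((r - 1) div 2) = - 1" if "r mod 4 = 3 \<and> q mod 4 = 3"
  proof -
    have "odd ((r - 1) div 2)" using that by presburger
    then show ?thesis using sigma_eq_m1 q that by simp
  qed
  have "card (B n) = q ^ (2 * r - 1)" using card_B q r by simp
  moreover have "int (card (H \<inter> B n)) \<in>
      {int q ^ (2 * r - 3) - int q ^ ((3 * r - 5) div 2), int q ^ (2 * r - 3),
       int q ^ (2 * r - 3) - int q ^ ((3 * r - 5) div 2) + int q ^ ((3 * (r - 1)) div 2)}"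
    if "r mod 4 = 1 \<or> odd r \<and> q mod 4 = 1" "H \<in> hyperplanes r" for H
  proof -
    have "odd r" using that(1) by presburger
    then show ?thesis using odd_case[OF that(2) _ s1[OF that(1)]] by auto
  qed
  moreover have "int (card (H \<inter> B n)) \<in>
      {int q ^ (2 * r - 3) + int q ^ ((3 * r - 5) div 2) - int q ^ ((3 * (r - 1)) div 2),
       int q ^ (2 * r - 3), int q ^ (2 * r - 3) + int q ^ ((3 * r - 5) div 2)}"
    if "r mod 4 = 3 \<and> q mod 4 = 3" "H \<in> hyperplanes r" for H
  proof -
    have "odd r" using that(1) by presburger
    then show ?thesis using odd_case[OF that(2) _ s2[OF that(1)]] by auto
  qed
  moreover have "minimal_intersection_set r (Min (intersection_numbers r (B n))) (B n)" if "r > 2"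
    using minimal_B[of n] r that by simp
  ultimately show ?thesis unfolding BB using even_case by blast
qed

end
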